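(* Suppose $h\in C^2(\overline R)$ with finite $C^2$ norm is a solution of the height equation with $\inf_R h_p>0$, and that there are functions $H_\pm$ on $[-1,0]$ with $h(q,p)\to H_\pm(p)$ pointwise as $q\to\pm\infty$. If $$H_+\ge H_-=H\ \text{on }[-1,0]\qquad\text{or}\qquad H_+\le H_-=H\ \text{on }[-1,0],$$ then $H_+=H_-=H$. The same holds with the roles of $H_-$ and $H_+$ interchanged.
   Context: Fix $\alpha\in(0,1)$, $\rho\in C^{2+\alpha}([-1,0])$ with $\rho>0$, $\rho_p\le0$, $H\in C^{3+\alpha}([-1,0])$ with $H(-1)=0$, $H(0)=1$, $H_p>0$, and $F>0$. Let $R=\mathbb R\times(-1,0)$ (coordinates $(q,p)$), $T=\mathbb R\times\{0\}$, $B=\mathbb R\times\{-1\}$. The height equation for $h$ is $\big(-\frac{1+h_q^2}{2h_p^2}+\frac1{2H_p^2}\big)_p+\big(\frac{h_q}{h_p}\big)_q-\frac1{F^2}\rho_p(h-H)=0$ in $R$, $\frac{1+h_q^2}{2h_p^2}-\frac1{2H_p^2}+\frac1{F^2}\rho(h-1)=0$ on $T$, $h=0$ on $B$. *)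

theory Defs
  imports "HOL-Analysis.Analysis"
begin

definition holder_Ck :: "nat \<Rightarrow> real \<Rightarrow> real \<Rightarrow> real \<Rightarrow> (real \<Rightarrow> real) \<Rightarrow> bool" where
  "holder_Ck k \<alpha> a b f \<longleftrightarrow>
     (\<exists>D :: nat \<Rightarrow> real \<Rightarrow> real.
        (\<forall>x\<in>{a..b}. D 0 x = f x) \<and>
        (\<forall>j<k. \<forall>x\<in>{a..b}. (D j has_real_derivative D (Suc j) x) (at x within {a..b})) \<and>
        continuous_on {a..b} (D k) \<and>
        (\<exists>C. \<forall>x\<in>{a..b}. \<forall>y\<in>{a..b}. \<bar>D k x - D k y\<bar> \<le> C * \<bar>x - y\<bar> powr \<alpha>))"

definition Rbar :: "(real \<times> real) set" where
  "Rbar = {(q, p). -1 \<le> p \<and> p \<le> 0}"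

definition has_partials_strip ::
  "(real \<times> real \<Rightarrow> real) \<Rightarrow> (real \<times> real \<Rightarrow> real) \<Rightarrow> (real \<times> real \<Rightarrow> real) \<Rightarrow> bool" where
  "has_partials_strip f fq fp \<longleftrightarrow>
     (\<forall>q p. -1 \<le> p \<and> p \<le> 0 \<longrightarrow>
        ((\<lambda>t. f (t, p)) has_real_derivative fq (q, p)) (at q) \<and>
        ((\<lambda>s. f (q, s)) has_real_derivative fp (q, p)) (at p within {-1..0}))"

definition bounded_strip :: "(real \<times> real \<Rightarrow> real) \<Rightarrow> bool" where
  "bounded_strip f \<longleftrightarrow> (\<exists>M. \<forall>x\<in>Rbar. \<bar>f x\<bar> \<le> M)"

definition C2_bounded_strip ::
  "(real \<times> real \<Rightarrow> real) \<Rightarrow> (real \<times> real \<Rightarrow> real) \<Rightarrow> (real \<times> real \<Rightarrow> real) \<Rightarrow> bool" where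
  "C2_bounded_strip h hq hp \<longleftrightarrow>
     has_partials_strip h hq hp \<and>
     (\<exists>hqq hqp hpq hpp.
        has_partials_strip hq hqq hqp \<and> has_partials_strip hp hpq hpp \<and>
        (\<forall>g\<in>{h, hq, hp, hqq, hqp, hpq, hpp}. continuous_on Rbar g \<and> bounded_strip g))"

end

theory Submission
  imports Defs
begin

text \<open>
  The flow force, the conserved quantity attached to translations in \<open>q\<close>, has the same value at both
  ends. Bounded second derivatives force \<open>h\<^sub>q \<rightarrow> 0\<close> and \<open>h\<^sub>p \<rightarrow> K'\<close> as
  \<open>h \<rightarrow> K\<close>, so each limit \<open>K\<close> is a \<open>q\<close>-independent solution of the height equation with the flow
  force of \<open>H\<close>. For \<open>w = K - H\<close> and \<open>A = 1 / (2 K'\<^sup>2) - 1 / (2 H'\<^sup>2)\<close> the height equation reads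
  \<open>A' = - \<rho>\<^sub>p w / F\<^sup>2\<close> with \<open>A(0) = - \<rho>(0) w(0) / F\<^sup>2\<close>; substituting this into the equality of flow
  forces and integrating by parts gives \<open>\<integral> w'\<^sup>3 / (K'\<^sup>2 H'\<^sup>2) = 0\<close>. If \<open>w\<close> has a sign, then \<open>A\<close> has the
  opposite sign because \<open>\<rho>\<^sub>p \<le> 0 < \<rho>\<close>, so \<open>w'\<close> has the sign of \<open>w\<close>, and the integral forces \<open>w' = 0\<close>.
\<close>

section \<open>Quadratic remainders and convergence of derivatives\<close>

text \<open>The mean value inequality is used twice: \<open>g\<close> is \<open>M\<close>-Lipschitz,
  so between \<open>p\<close> and \<open>s\<close> the derivative \<open>g x - g p\<close> of
  \<open>f x - g p * x\<close> is at most \<open>M * \<bar>s - p\<bar>\<close>. This costs a factor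
  2 against Taylor's formula but asks only for a bound on \<open>g'\<close>.\<close>

lemma derivative_remainder_bound:
  fixes f g g' :: "real \<Rightarrow> real"
  assumes "convex S"
    and f: "\<And>x. x \<in> S \<Longrightarrow> (f has_real_derivative g x) (at x within S)"
    and g: "\<And>x. x \<in> S \<Longrightarrow> (g has_real_derivative g' x) (at x within S)"
    and g': "\<And>x. x \<in> S \<Longrightarrow> \<bar>g' x\<bar> \<le> M"
    and S: "p \<in> S" "s \<in> S"
  shows "\<bar>f s - f p - g p * (s - p)\<bar> \<le> M * (s - p)\<^sup>2"
proof -
  have "0 \<le> M" using g' S by (meson abs_ge_zero order_trans)
  let ?T = "closed_segment p s"
  have TS: "?T \<subseteq> S" using S \<open>convex S\<close> by (simp add: closed_segment_subset)
  have lip: "\<bar>g x - g p\<bar> \<le> M * \<bar>x - p\<bar>" if "x \<in> S" for x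
    using field_differentiable_bound[OF \<open>convex S\<close> g _ that \<open>p \<in> S\<close>, of M] g' by simp
  have b: "\<bar>g x - g p\<bar> \<le> M * \<bar>s - p\<bar>" if "x \<in> ?T" for x
  proof -
    have "\<bar>x - p\<bar> \<le> \<bar>s - p\<bar>" using that
      by (simp add: closed_segment_eq_real_ivl split: if_splits)
    then show ?thesis using lip[of x] that TS \<open>0 \<le> M\<close>
      by (meson mult_left_mono order_trans subsetD)
  qed
  have "norm ((f s - g p * s) - (f p - g p * p)) \<le> (M * \<bar>s - p\<bar>) * norm (s - p)"
  proof (rule field_differentiable_bound[of ?T "\<lambda>x. f x - g p * x" "\<lambda>x. g x - g p"])
    fix x assume "x \<in> ?T"
    then show "((\<lambda>x. f x - g p * x) has_real_derivative g x - g p) (at x within ?T)"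
      using DERIV_subset[OF f TS] TS by (auto intro!: derivative_eq_intros)
    show "norm (g x - g p) \<le> M * \<bar>s - p\<bar>" using b[OF \<open>x \<in> ?T\<close>] by simp
  qed auto
  then show ?thesis by (simp add: algebra_simps power2_eq_square flip: abs_mult)
qed

text \<open>Landau's interpolation argument: a bounded second derivative upgrades pointwise convergence
  of functions to convergence of their derivatives.\<close>

lemma tendsto_derivative_of_quadratic_remainder:
  fixes f :: "'x \<Rightarrow> real \<Rightarrow> real" and g :: "'x \<Rightarrow> real"
  assumes lim: "\<And>s. s \<in> S \<Longrightarrow> ((\<lambda>x. f x s) \<longlongrightarrow> K s) Fl"
    and rem: "\<And>x s. s \<in> S \<Longrightarrow> \<bar>f x s - f x p - g x * (s - p)\<bar> \<le> M * (s - p)\<^sup>2"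
    and g: "\<And>x. \<bar>g x\<bar> \<le> C"
    and X: "filterlim X Fl sequentially"
    and p: "p \<in> S" "p islimpt S"
  obtains G where "(g \<longlongrightarrow> G) Fl" "(K has_real_derivative G) (at p within S)"
proof -
  obtain s0 where "s0 \<in> S" "s0 \<noteq> p" using p(2) by (meson islimptE UNIV_I open_UNIV)
  have "0 \<le> M * (s0 - p)\<^sup>2" using rem[OF \<open>s0 \<in> S\<close>] by (meson abs_ge_zero order_trans)
  then have "0 \<le> M" using \<open>s0 \<noteq> p\<close> by (simp add: zero_le_mult_iff)
  \<comment> \<open>Compactness along the single sequence \<open>X\<close> supplies a candidate
    \<open>G\<close>. Its remainder estimate \<open>KG\<close> for \<open>K\<close> is then compared
    with \<open>rem\<close> along the whole filter.\<close>
  have "\<forall>n. (g \<circ> X) n \<in> {-C..C}" using g by (simp add: abs_le_iff minus_le_iff)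
  then obtain G r where r: "strict_mono r" "((g \<circ> X) \<circ> r) \<longlonglongrightarrow> G"
    using compact_Icc[of "-C" C] unfolding compact_def by blast
  have Xr: "filterlim (\<lambda>n. X (r n)) Fl sequentially"
    using filterlim_compose[OF X filterlim_subseq[OF r(1)]] .
  have KG: "\<bar>K s - K p - G * (s - p)\<bar> \<le> M * (s - p)\<^sup>2" if "s \<in> S" for s
  proof (rule tendsto_upperbound)
    show "(\<lambda>n. \<bar>f (X (r n)) s - f (X (r n)) p - g (X (r n)) * (s - p)\<bar>)
        \<longlonglongrightarrow> \<bar>K s - K p - G * (s - p)\<bar>"
      using filterlim_compose[OF lim[OF that] Xr] filterlim_compose[OF lim[OF p(1)] Xr] r(2)
      by (intro tendsto_intros) (auto simp: o_def)
  qed (use rem[OF that] in auto)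
  have "(g \<longlongrightarrow> G) Fl"
  proof (rule tendstoI)
    fix e :: real assume "e > 0"
    \<comment> \<open>The remainders of \<open>f x\<close> and of \<open>K\<close>, divided by
      \<open>\<bar>s - p\<bar> < d\<close>, contribute at most \<open>2 * M * d \<le> e / 2\<close>;
      the convergence at \<open>s\<close> and \<open>p\<close> pays for the other half. Taking
      \<open>M + 1\<close> covers \<open>M = 0\<close>.\<close>
    define d where "d = e / (4 * (M + 1))"
    have "d > 0" using \<open>e > 0\<close> \<open>0 \<le> M\<close> by (simp add: d_def)
    then obtain s where s: "s \<in> S" "s \<noteq> p" "\<bar>s - p\<bar> < d"
      using p(2) unfolding islimpt_approachable by (auto simp: dist_real_def)
    define t where "t = \<bar>s - p\<bar>"
    have "t > 0" "t < d" using s by (auto simp: t_def)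
    have Md: "2 * M * d \<le> e / 2" using \<open>e > 0\<close> \<open>0 \<le> M\<close> by (simp add: d_def field_simps)
    have l: "((\<lambda>x. \<bar>(f x s - f x p) - (K s - K p)\<bar>) \<longlongrightarrow> \<bar>(K s - K p) - (K s - K p)\<bar>) Fl"
      by (intro tendsto_intros lim s p)
    have "\<forall>\<^sub>F x in Fl. \<bar>(f x s - f x p) - (K s - K p)\<bar> < e * t / 2"
      by (rule order_tendstoD(2)[OF l]) (use \<open>e > 0\<close> \<open>t > 0\<close> in auto)
    then show "\<forall>\<^sub>F x in Fl. dist (g x) G < e"
    proof eventually_elim
      case (elim x)
      have "\<bar>g x - G\<bar> * t = \<bar>g x * (s - p) - G * (s - p)\<bar>"
        unfolding t_def by (simp add: left_diff_distrib flip: abs_mult)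
      also have "\<dots> < M * (s - p)\<^sup>2 + M * (s - p)\<^sup>2 + e * t / 2"
        using elim rem[OF s(1), of x] KG[OF s(1)] by linarith
      also have "\<dots> = (2 * M * t + e / 2) * t"
        by (simp add: t_def algebra_simps power2_eq_square flip: abs_mult)
      finally have "\<bar>g x - G\<bar> < 2 * M * t + e / 2" using \<open>t > 0\<close> by simp
      moreover have "2 * M * t \<le> 2 * M * d" using \<open>t < d\<close> \<open>0 \<le> M\<close> by (simp add: mult_left_mono)
      ultimately show ?case using Md by (simp add: dist_real_def)
    qed
  qed
  moreover have "(K has_real_derivative G) (at p within S)"
  proof -
    have "((\<lambda>s. (K s - K p) / (s - p) - G) \<longlongrightarrow> 0) (at p within S)"
    proof (rule Lim_null_comparison)
      show "\<forall>\<^sub>F s in at p within S. norm ((K s - K p) / (s - p) - G) \<le> M * \<bar>s - p\<bar>"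
        unfolding eventually_at_filter
      proof (intro always_eventually allI impI)
        fix s assume "s \<noteq> p" "s \<in> S"
        have "\<bar>(K s - K p) / (s - p) - G\<bar> * \<bar>s - p\<bar> = \<bar>K s - K p - G * (s - p)\<bar>"
          unfolding abs_mult[symmetric] left_diff_distrib using \<open>s \<noteq> p\<close> by simp
        also have "\<dots> \<le> (M * \<bar>s - p\<bar>) * \<bar>s - p\<bar>"
          using KG[OF \<open>s \<in> S\<close>] by (simp add: power2_eq_square mult.assoc flip: abs_mult)
        finally show "norm ((K s - K p) / (s - p) - G) \<le> M * \<bar>s - p\<bar>"
          using \<open>s \<noteq> p\<close> by simp
      qed
      have "((\<lambda>s. M * \<bar>s - p\<bar>) \<longlongrightarrow> M * \<bar>p - p\<bar>) (at p within S)" by (intro tendsto_intros)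
      then show "((\<lambda>s. M * \<bar>s - p\<bar>) \<longlongrightarrow> 0) (at p within S)" by simp
    qed
    then show ?thesis unfolding has_field_derivative_iff by (simp add: LIM_zero_iff)
  qed
  ultimately show thesis using that by blast
qed

section \<open>Conjugate flows ordered with respect to \<open>H\<close>\<close>

text \<open>The sign \<open>s\<close> treats \<open>K \<ge> H\<close> and \<open>K \<le> H\<close> at once.\<close>

lemma ordered_conjugate_flow_eq:
  fixes H Hp K Kp \<sigma> :: "real \<Rightarrow> real" and \<tau> s :: real
  assumes dH: "\<And>p. p \<in> {-1..0} \<Longrightarrow> (H has_real_derivative Hp p) (at p within {-1..0})"
    and dK: "\<And>p. p \<in> {-1..0} \<Longrightarrow> (K has_real_derivative Kp p) (at p within {-1..0})"
    and cHp: "continuous_on {-1..0} Hp" and cKp: "continuous_on {-1..0} Kp"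
    and c\<sigma>: "continuous_on {-1..0} \<sigma>"
    and Hp: "\<And>p. p \<in> {-1..0} \<Longrightarrow> Hp p > 0" and Kp: "\<And>p. p \<in> {-1..0} \<Longrightarrow> Kp p > 0"
    and \<sigma>: "\<And>p. p \<in> {-1..0} \<Longrightarrow> \<sigma> p \<le> 0" and \<tau>: "\<tau> \<ge> 0"
    and bot: "K (-1) = H (-1)"
    and ode: "\<And>p. p \<in> {-1..0} \<Longrightarrow> 1 / (2 * (Kp p)\<^sup>2) - 1 / (2 * (Hp p)\<^sup>2)
        = integral {p..0} (\<lambda>t. \<sigma> t * (K t - H t)) - \<tau> * (K 0 - H 0)"
    and force: "integral {-1..0} (\<lambda>p. 1 / (2 * Kp p) + Kp p / (2 * (Hp p)\<^sup>2) + \<sigma> p * (K p - H p)\<^sup>2 / 2)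
        - \<tau> * (K 0 - H 0)\<^sup>2 / 2 = integral {-1..0} (\<lambda>p. 1 / Hp p)"
    and s: "s = 1 \<or> s = -1" and ord: "\<And>p. p \<in> {-1..0} \<Longrightarrow> s * (K p - H p) \<ge> 0"
    and p: "p \<in> {-1..0}"
  shows "K p = H p"
proof -
  let ?I = "{-1..0::real}"
  define w where "w p = K p - H p" for p
  define wp where "wp p = Kp p - Hp p" for p
  define A where "A p = 1 / (2 * (Kp p)\<^sup>2) - 1 / (2 * (Hp p)\<^sup>2)" for p
  define Q where "Q p = (wp p)^3 / (4 * (Kp p)\<^sup>2 * (Hp p)\<^sup>2)" for p
  have dw: "(w has_real_derivative wp p) (at p within ?I)" if "p \<in> ?I" for p
    unfolding w_def wp_def using dK[OF that] dH[OF that] by (rule DERIV_diff)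
  have cw: "continuous_on ?I w" using dw by (meson DERIV_continuous_on)
  have c\<sigma>w: "continuous_on ?I (\<lambda>t. \<sigma> t * w t)" by (intro continuous_intros c\<sigma> cw)
  have A: "A p = integral {p..0} (\<lambda>t. \<sigma> t * w t) - \<tau> * w 0" if "p \<in> ?I" for p
    using ode[OF that] by (simp add: A_def w_def)
  have dA: "(A has_real_derivative - (\<sigma> p * w p)) (at p within ?I)" if "p \<in> ?I" for p
  proof -
    have "((\<lambda>p. integral {p..0} (\<lambda>t. \<sigma> t * w t)) has_real_derivative - (\<sigma> p * w p)) (at p within ?I)"
      by (rule integral_has_real_derivative'[OF c\<sigma>w that])
    then have "((\<lambda>p. integral {p..0} (\<lambda>t. \<sigma> t * w t) - \<tau> * w 0)
        has_real_derivative - (\<sigma> p * w p)) (at p within ?I)"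
      by (auto intro!: derivative_eq_intros)
    then show ?thesis
      by (rule has_field_derivative_transform_within[OF _ zero_less_one that]) (use A in auto)
  qed
  have cwp: "continuous_on ?I wp" unfolding wp_def by (intro continuous_intros cHp cKp)
  have ne: "Hp p \<noteq> 0" "Kp p \<noteq> 0" if "p \<in> ?I" for p using Hp[OF that] Kp[OF that] by auto
  have cQ: "continuous_on ?I Q" unfolding Q_def
    by (intro continuous_intros cHp cKp cwp) (use ne in auto)
  \<comment> \<open>The integrand is the derivative of \<open>A * w\<close>, so only boundary values
    remain: \<open>w (-1) = 0\<close> and \<open>A 0 = - \<tau> * w 0\<close>.\<close>
  have intAw: "((\<lambda>p. - (\<sigma> p * w p) * w p + A p * wp p) has_integral \<tau> * (-(w 0)\<^sup>2)) ?I"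
  proof -
    have "((\<lambda>p. A p * w p) has_vector_derivative - (\<sigma> p * w p) * w p + A p * wp p) (at p within ?I)"
      if "p \<in> ?I" for p
      using DERIV_mult[OF dA[OF that] dw[OF that]]
      by (simp add: has_real_derivative_iff_has_vector_derivative[symmetric] algebra_simps)
    then have "((\<lambda>p. - (\<sigma> p * w p) * w p + A p * wp p) has_integral A 0 * w 0 - A (-1) * w (-1)) ?I"
      by (intro fundamental_theorem_of_calculus) auto
    moreover have "w (-1) = 0" by (simp add: w_def bot)
    ultimately show ?thesis using A[of 0] by (simp add: power2_eq_square mult.assoc)
  qed
  let ?D = "\<lambda>p. 1 / (2 * Kp p) + Kp p / (2 * (Hp p)\<^sup>2) + \<sigma> p * (K p - H p)\<^sup>2 / 2"
  \<comment> \<open>The part without \<open>\<sigma>\<close> on the left is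
    \<open>wp^2 / (2 * Kp * Hp^2)\<close>, and
    \<open>A * wp = - wp^2 * (Kp + Hp) / (2 * Kp^2 * Hp^2)\<close>. Adding half of the latter turns
    the square into the cube \<open>Q\<close>.\<close>
  have ptw: "?D p - 1 / Hp p = Q p - 1/2 * (- (\<sigma> p * w p) * w p + A p * wp p)" if "p \<in> ?I" for p
    using ne[OF that] unfolding Q_def A_def w_def wp_def
    by (simp add: field_simps power2_eq_square power3_eq_cube)
  have cK: "continuous_on ?I K" and cH: "continuous_on ?I H"
    using dK dH by (meson DERIV_continuous_on)+
  have iD: "?D integrable_on ?I"
    by (intro integrable_continuous_real continuous_intros cKp cHp c\<sigma> cK cH) (use ne in auto)
  have iH: "(\<lambda>p. 1 / Hp p) integrable_on ?I"
    by (intro integrable_continuous_real continuous_intros cHp) (use ne in auto)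
  have iQ: "Q integrable_on ?I" by (intro integrable_continuous_real cQ)
  have "integral ?I ?D - integral ?I (\<lambda>p. 1 / Hp p) = integral ?I (\<lambda>p. ?D p - 1 / Hp p)"
    by (rule integral_diff[symmetric, OF iD iH])
  also have "\<dots> = integral ?I (\<lambda>p. Q p - 1/2 * (- (\<sigma> p * w p) * w p + A p * wp p))"
    using ptw by (intro integral_cong) auto
  also have "\<dots> = integral ?I Q - 1/2 * (\<tau> * (-(w 0)\<^sup>2))"
    by (intro integral_unique has_integral_diff integrable_integral[OF iQ] has_integral_mult_right intAw)
  \<comment> \<open>The boundary term of \<open>intAw\<close> cancels the surface term in
    \<open>force\<close>.\<close>
  finally have Q0: "integral ?I Q = 0" using force by (simp add: w_def)
  have sA: "s * A p \<le> 0" if "p \<in> ?I" for p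
  proof -
    have "s * integral {p..0} (\<lambda>t. \<sigma> t * w t) = integral {p..0} (\<lambda>t. \<sigma> t * (s * w t))"
      by (simp add: mult.left_commute)
    also have "\<dots> \<le> integral {p..0} (\<lambda>t. 0)"
    proof (rule integral_le)
      show "(\<lambda>t. \<sigma> t * (s * w t)) integrable_on {p..0}"
        using continuous_on_subset[OF cw] continuous_on_subset[OF c\<sigma>] that
        by (intro integrable_continuous_real continuous_intros) auto
      show "\<sigma> t * (s * w t) \<le> 0" if "t \<in> {p..0}" for t
        using \<sigma>[of t] ord[of t] that \<open>p \<in> ?I\<close> by (auto simp: w_def mult_nonpos_nonneg)
    qed auto
    finally have "s * integral {p..0} (\<lambda>t. \<sigma> t * w t) \<le> 0" by simp
    moreover have "\<tau> * (s * w 0) \<ge> 0" using \<tau> ord[of 0] by (simp add: w_def)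
    ultimately show ?thesis unfolding A[OF that] by (simp add: right_diff_distrib mult.left_commute)
  qed
  \<comment> \<open>Factoring the difference of inverse squares shows that \<open>A\<close> and
    \<open>wp\<close> have opposite signs.\<close>
  have swp: "s * wp p \<ge> 0" if "p \<in> ?I" for p
  proof -
    have "A p = - wp p * ((Kp p + Hp p) / (2 * (Kp p)\<^sup>2 * (Hp p)\<^sup>2))"
      using ne[OF that] unfolding A_def wp_def by (simp add: field_simps power2_eq_square)
    then have "s * wp p * ((Kp p + Hp p) / (2 * (Kp p)\<^sup>2 * (Hp p)\<^sup>2)) \<ge> 0"
      using sA[OF that] by simp
    moreover have "(Kp p + Hp p) / (2 * (Kp p)\<^sup>2 * (Hp p)\<^sup>2) > 0"
      using Hp[OF that] Kp[OF that] by (simp add: add_pos_pos)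
    ultimately show ?thesis by (metis mult.commute zero_le_mult_iff not_less order.strict_implies_order linorder_not_le)
  qed
  \<comment> \<open>Since \<open>s^3 = s\<close>, the sign can be moved inside the cube; the
    integrand \<open>s * Q\<close> is therefore nonnegative with integral zero.\<close>
  have "s * Q p = (s * wp p)^3 / (4 * (Kp p)\<^sup>2 * (Hp p)\<^sup>2)" for p
    using s by (auto simp: Q_def power3_eq_cube)
  then have "s * Q p \<ge> 0" if "p \<in> ?I" for p using swp[OF that] by simp
  moreover have "continuous_on ?I (\<lambda>p. s * Q p)" by (intro continuous_intros cQ)
  moreover have "integral ?I (\<lambda>p. s * Q p) = 0" by (simp add: Q0)
  ultimately have "\<forall>p\<in>?I. s * Q p = 0"
    using integral_eq_0_iff[of "-1" 0 "\<lambda>p. s * Q p"] by simp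
  then have "wp p = 0" if "p \<in> ?I" for p using s ne[OF that] that by (auto simp: Q_def)
  then have "w p = w (-1)"
    using has_field_derivative_zero_constant[of ?I w] dw p
    by (metis atLeastAtMost_iff convex_real_interval(5) order_refl neg_le_0_iff_le zero_le_one)
  then show ?thesis by (simp add: w_def bot)
qed

section \<open>Real-variable lemmas and slices of the strip\<close>

text \<open>On unit intervals moving off to infinity the increments of \<open>f\<close> tend to
  \<open>l - l = 0\<close>, while by the mean value theorem they are values of \<open>f'\<close>,
  which tend to \<open>L\<close>. The limits are taken along sequences, to fit the dominated
  convergence theorem.\<close>

lemma limit_of_derivative_eq_zero:
  fixes f f' :: "real \<Rightarrow> real"
  assumes Fl: "Fl = at_top \<or> Fl = at_bot"
    and f: "\<And>x. (f has_real_derivative f' x) (at x)"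
    and lim: "\<And>X. filterlim X Fl sequentially \<Longrightarrow> (\<lambda>n. f (X n)) \<longlonglongrightarrow> l"
    and lim': "\<And>X. filterlim X Fl sequentially \<Longrightarrow> (\<lambda>n. f' (X n)) \<longlonglongrightarrow> L"
  shows "L = 0"
proof -
  obtain Y :: "nat \<Rightarrow> real"
    where Y: "\<And>X. (\<And>n. Y n \<le> X n \<and> X n \<le> Y n + 1) \<Longrightarrow> filterlim X Fl sequentially"
  proof (cases "Fl = at_top")
    case True
    show thesis
      by (rule that[of real])
        (use True filterlim_at_top_mono[OF filterlim_real_sequentially] in auto)
  next
    case False
    have *: "filterlim X at_bot sequentially"
      if "\<And>n. X n \<le> - real n" for X
      unfolding filterlim_uminus_at_bot
      by (rule filterlim_at_top_mono[OF filterlim_real_sequentially])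
        (use that in \<open>auto simp: le_minus_iff\<close>)
    show thesis
      \<comment> \<open>The extra \<open>- 1\<close> keeps the right endpoint \<open>Y n + 1\<close>
        below \<open>- real n\<close>.\<close>
      by (rule that[of "\<lambda>n. - real n - 1"]) (use False Fl * in auto)
  qed
  have "\<exists>z. Y n < z \<and> z < Y n + 1 \<and> f (Y n + 1) - f (Y n) = f' z" for n
    using MVT2[of "Y n" "Y n + 1" f f'] f by auto
  then obtain Z where Z: "\<And>n. Y n < Z n \<and> Z n < Y n + 1 \<and> f (Y n + 1) - f (Y n) = f' (Z n)"
    by metis
  have "(\<lambda>n. f (Y n + 1) - f (Y n)) \<longlonglongrightarrow> l - l"
    by (intro tendsto_diff lim Y) auto
  moreover have "(\<lambda>n. f' (Z n)) \<longlonglongrightarrow> L"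
    by (intro lim' Y) (use Z in \<open>auto intro: less_imp_le\<close>)
  ultimately show "L = 0" using Z LIMSEQ_unique by fastforce
qed

lemma has_real_derivative_unique_Icc:
  fixes f :: "real \<Rightarrow> real"
  assumes "(f has_real_derivative u) (at x within {a..b})"
    and "(f has_real_derivative v) (at x within {a..b})" and "a < b" "x \<in> {a..b}"
  shows "u = v"
  using vector_derivative_unique_within_closed_interval[of a b x f u v] assms
  by (auto simp: has_real_derivative_iff_has_vector_derivative)

lemma Rbar_eq_Times: "Rbar = UNIV \<times> {-1..0}"
  by (auto simp: Rbar_def)

lemma continuous_on_slice:
  assumes "continuous_on Rbar g"
  shows "continuous_on {-1..0} (\<lambda>s. g (q, s))"
  by (rule continuous_on_compose2[OF assms]) (auto simp: Rbar_def intro!: continuous_intros)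

section \<open>Solutions on the strip and their mixed partials\<close>

text \<open>In the height equation \<open>\<sigma> = \<rho>\<^sub>p / F\<^sup>2\<close> and \<open>\<tau> = \<rho>(0) / F\<^sup>2\<close>.\<close>

locale strip_solution =
  fixes \<sigma> H Hp :: "real \<Rightarrow> real" and \<tau> M \<delta> :: real
    and h hq hp hqq hqp hpq hpp :: "real \<times> real \<Rightarrow> real"
  assumes \<sigma>_cont: "continuous_on {-1..0} \<sigma>"
    and H_deriv: "p \<in> {-1..0} \<Longrightarrow> (H has_real_derivative Hp p) (at p within {-1..0})"
    and Hp_cont: "continuous_on {-1..0} Hp"
    and Hp_pos: "p \<in> {-1..0} \<Longrightarrow> Hp p > 0"
    and H_bot: "H (-1) = 0" and H_top: "H 0 = 1"
    and h_partials: "has_partials_strip h hq hp"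
    and hq_partials: "has_partials_strip hq hqq hqp"
    and hp_partials: "has_partials_strip hp hpq hpp"
    and cont: "g \<in> {h, hq, hp, hqq, hqp, hpq, hpp} \<Longrightarrow> continuous_on Rbar g"
    and bound: "g \<in> {h, hq, hp, hqq, hqp, hpq, hpp} \<Longrightarrow> x \<in> Rbar \<Longrightarrow> \<bar>g x\<bar> \<le> M"
    and \<delta>_pos: "\<delta> > 0" and hp_ge: "x \<in> Rbar \<Longrightarrow> hp x \<ge> \<delta>"
    and interior: "-1 < p \<Longrightarrow> p < 0 \<Longrightarrow>
        ((\<lambda>s. - (1 + (hq (q, s))\<^sup>2) / (2 * (hp (q, s))\<^sup>2) + 1 / (2 * (Hp s)\<^sup>2))
          has_real_derivative
            \<sigma> p * (h (q, p) - H p)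
            - (hqq (q, p) * hp (q, p) - hq (q, p) * hpq (q, p)) / (hp (q, p))\<^sup>2) (at p)"
    and top: "- (1 + (hq (q, 0))\<^sup>2) / (2 * (hp (q, 0))\<^sup>2) + 1 / (2 * (Hp 0)\<^sup>2)
        = \<tau> * (h (q, 0) - 1)"
    and bot: "h (q, -1) = 0"
begin

lemma H_cont: "continuous_on {-1..0} H"
  using H_deriv by (meson DERIV_continuous_on)

lemma hp_pos: "p \<in> {-1..0} \<Longrightarrow> hp (q, p) > 0"
  using hp_ge[of "(q, p)"] \<delta>_pos by (simp add: Rbar_def)

lemma hp_nonzero: "x \<in> Rbar \<Longrightarrow> hp x \<noteq> 0"
  using hp_ge[of x] \<delta>_pos by auto

lemma cont_snd:
  assumes "continuous_on {-1..0} f"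
  shows "continuous_on Rbar (\<lambda>x. f (snd x))"
  by (rule continuous_on_compose2[OF assms]) (auto simp: Rbar_def intro!: continuous_intros)

lemma partials:
  assumes "p \<in> {-1..0}"
  shows "((\<lambda>t. h (t, p)) has_real_derivative hq (q, p)) (at q)"
    and "((\<lambda>s. h (q, s)) has_real_derivative hp (q, p)) (at p within {-1..0})"
    and "((\<lambda>t. hq (t, p)) has_real_derivative hqq (q, p)) (at q)"
    and "((\<lambda>s. hq (q, s)) has_real_derivative hqp (q, p)) (at p within {-1..0})"
    and "((\<lambda>t. hp (t, p)) has_real_derivative hpq (q, p)) (at q)"
    and "((\<lambda>s. hp (q, s)) has_real_derivative hpp (q, p)) (at p within {-1..0})"
  using h_partials hq_partials hp_partials assms by (auto simp: has_partials_strip_def)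

lemma conts:
  shows "continuous_on Rbar h" "continuous_on Rbar hq" "continuous_on Rbar hp"
    "continuous_on Rbar hqq" "continuous_on Rbar hqp" "continuous_on Rbar hpq" "continuous_on Rbar hpp"
  by (auto intro: cont)

lemma leibniz:
  assumes f: "\<And>q s. s \<in> {a..b} \<Longrightarrow> ((\<lambda>t. f (t, s)) has_real_derivative g (q, s)) (at q)"
    and "continuous_on Rbar f" "continuous_on Rbar g" "{a..b} \<subseteq> {-1..0}"
  shows "((\<lambda>q. integral {a..b} (\<lambda>s. f (q, s))) has_real_derivative
    integral {a..b} (\<lambda>s. g (q, s))) (at q)"
proof -
  have "continuous_on (UNIV \<times> cbox a b) (\<lambda>(x, t). g (x, t))"
    using continuous_on_subset[OF \<open>continuous_on Rbar g\<close>] assms(4)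
    by (simp add: Rbar_eq_Times Sigma_mono)
  moreover have "(\<lambda>s. f (x, s)) integrable_on cbox a b" for x
    using continuous_on_subset[OF continuous_on_slice[OF \<open>continuous_on Rbar f\<close>] assms(4)]
    by (simp add: integrable_continuous_real)
  ultimately show ?thesis
    using leibniz_rule_field_derivative[of UNIV a b "\<lambda>q s. f (q, s)" "\<lambda>q s. g (q, s)" q] f
    by simp
qed

text \<open>Since \<open>h\<close> vanishes at the bottom, it is the integral of \<open>hp\<close>
  from \<open>-1\<close>. Differentiating under the integral in \<open>q\<close> writes
  \<open>hq\<close> as the integral of \<open>hpq\<close>, and differentiating that in
  \<open>p\<close> gives the claim, including at the boundary, where the
  \<open>p\<close>-derivatives are one-sided.\<close>

lemma mixed_partials_eq:
  assumes p: "p \<in> {-1..0}"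
  shows "hqp (q, p) = hpq (q, p)"
proof -
  have hq: "hq (q, p) = integral {-1..p} (\<lambda>s. hpq (q, s))" if p: "p \<in> {-1..0}" for p
  proof -
    have sub: "{-1..p} \<subseteq> {-1..0}" using p by auto
    have "((\<lambda>s. hp (t, s)) has_integral h (t, p) - h (t, -1)) {-1..p}" for t
      using p partials(2)[of _ t]
      by (intro fundamental_theorem_of_calculus)
        (auto simp flip: has_real_derivative_iff_has_vector_derivative intro!: DERIV_subset[OF _ sub])
    then have "integral {-1..p} (\<lambda>s. hp (t, s)) = h (t, p)" for t
      using bot by (simp add: integral_unique)
    moreover have "((\<lambda>t. integral {-1..p} (\<lambda>s. hp (t, s))) has_real_derivative
        integral {-1..p} (\<lambda>s. hpq (q, s))) (at q)"
      using sub by (intro leibniz conts partials) auto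
    ultimately show ?thesis using partials(1)[OF p, of q] DERIV_unique by simp
  qed
  have "((\<lambda>p. integral {-1..p} (\<lambda>s. hpq (q, s))) has_real_derivative hpq (q, p)) (at p within {-1..0})"
    by (rule integral_has_real_derivative[OF continuous_on_slice[OF conts(6)] p])
  then have "((\<lambda>p. hq (q, p)) has_real_derivative hpq (q, p)) (at p within {-1..0})"
    by (rule has_field_derivative_transform_within[OF _ zero_less_one p]) (use hq in auto)
  with partials(4)[OF p] show ?thesis
    by (rule has_real_derivative_unique_Icc) (use p in auto)
qed

section \<open>Conservation of the flow force\<close>

text \<open>The interior equation is the Euler-Lagrange equation of
  \<open>(1 + h\<^sub>q\<^sup>2) / (2 h\<^sub>p) + h\<^sub>p / (2 H\<^sub>p\<^sup>2) + \<sigma> (h - H)\<^sup>2 / 2\<close>; the conserved density below is the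
  Noether current of translations in \<open>q\<close>, and \<open>vertical_stress\<close> is the derivative of the Lagrangian
  with respect to \<open>h\<^sub>p\<close>.\<close>

definition momentum :: "real \<times> real \<Rightarrow> real" where
  "momentum x = (1 - (hq x)\<^sup>2) / (2 * hp x) + hp x / (2 * (Hp (snd x))\<^sup>2)
     + \<sigma> (snd x) * (h x - H (snd x))\<^sup>2 / 2"

text \<open>The surface term is chosen so that its \<open>q\<close>-derivative cancels the flux
  \<open>vertical_stress * hq\<close> at \<open>p = 0\<close>, which the top condition equates with
  \<open>\<tau> * (h - 1) * hq\<close>.\<close>

definition flow_force :: "real \<Rightarrow> real" where
  "flow_force q = integral {-1..0} (\<lambda>p. momentum (q, p)) - \<tau> * (h (q, 0) - 1)\<^sup>2 / 2"

definition vertical_stress :: "real \<times> real \<Rightarrow> real" where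
  "vertical_stress x = - (1 + (hq x)\<^sup>2) / (2 * (hp x)\<^sup>2) + 1 / (2 * (Hp (snd x))\<^sup>2)"

text \<open>This is the \<open>q\<close>-derivative of \<open>hq / hp\<close>, expanded by the
  quotient rule so that its continuity on the closed strip can be read off.\<close>

definition slope_q :: "real \<times> real \<Rightarrow> real" where
  "slope_q x = (hqq x * hp x - hq x * hpq x) / (hp x)\<^sup>2"

lemma Hp_snd_nonzero: "x \<in> Rbar \<Longrightarrow> Hp (snd x) \<noteq> 0"
  using Hp_pos[of "snd x"] by (auto simp: Rbar_def)

lemma cont_vertical_stress: "continuous_on Rbar vertical_stress"
  unfolding vertical_stress_def
  by (intro continuous_intros conts cont_snd Hp_cont) (use hp_nonzero Hp_snd_nonzero in auto)

lemma cont_slope_q: "continuous_on Rbar slope_q"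
  unfolding slope_q_def
  by (intro continuous_intros conts) (use hp_nonzero in auto)

lemma cont_momentum: "continuous_on Rbar momentum"
  unfolding momentum_def
  by (intro continuous_intros conts cont_snd Hp_cont \<sigma>_cont H_cont)
    (use hp_nonzero Hp_snd_nonzero in auto)

text \<open>The \<open>q\<close>-derivative \<open>mq\<close> of \<open>momentum\<close> equals the
  \<open>p\<close>-derivative of \<open>vertical_stress * hq\<close>. Its integral over a vertical
  slice is thus a boundary flux: zero at the bottom, where \<open>hq = 0\<close>, and balanced by
  the surface term at the top.\<close>

lemma flow_force_constant: "flow_force q = flow_force 0"
proof -
  define mq where "mq x = - hq x * hqq x / hp x - (1 - (hq x)\<^sup>2) * hpq x / (2 * (hp x)\<^sup>2)
      + hpq x / (2 * (Hp (snd x))\<^sup>2) + \<sigma> (snd x) * (h x - H (snd x)) * hq x" for x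
  have cmq: "continuous_on Rbar mq" unfolding mq_def
    by (intro continuous_intros conts cont_snd Hp_cont \<sigma>_cont H_cont)
      (use hp_nonzero Hp_snd_nonzero in auto)
  have dm: "((\<lambda>t. momentum (t, p)) has_real_derivative mq (q, p)) (at q)" if p: "p \<in> {-1..0}" for p q
    unfolding momentum_def mq_def
    using hp_pos[OF p, of q] Hp_pos[OF p]
    by (auto intro!: derivative_eq_intros partials(1,3,5)[OF p] simp: field_simps power2_eq_square)
  have "(flow_force has_real_derivative 0) (at q)" for q
  proof -
    \<comment> \<open>The equation is available only for \<open>-1 < p < 0\<close>; continuity of
      the product up to the ends then lets the fundamental theorem reach the boundary.\<close>
    have "((\<lambda>p. vertical_stress (q, p) * hq (q, p)) has_vector_derivative mq (q, p)) (at p)"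
      if "p \<in> {-1<..<0}" for p
    proof -
      have p: "p \<in> {-1..0}" using that by auto
      have "((\<lambda>s. hq (q, s)) has_real_derivative hpq (q, p)) (at p)"
        using partials(4)[OF p, of q] at_within_interior[of p "{-1..0}"] that
        unfolding mixed_partials_eq[OF p] by simp
      moreover have "((\<lambda>s. vertical_stress (q, s)) has_real_derivative
          \<sigma> p * (h (q, p) - H p) - slope_q (q, p)) (at p)"
        using interior[of p q] that by (simp add: vertical_stress_def slope_q_def)
      ultimately have "((\<lambda>p. vertical_stress (q, p) * hq (q, p)) has_real_derivative
          (\<sigma> p * (h (q, p) - H p) - slope_q (q, p)) * hq (q, p)
            + hpq (q, p) * vertical_stress (q, p)) (at p)"
        by (intro DERIV_mult)
      also have "(\<sigma> p * (h (q, p) - H p) - slope_q (q, p)) * hq (q, p)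
            + hpq (q, p) * vertical_stress (q, p) = mq (q, p)"
        using hp_pos[OF p, of q] Hp_pos[OF p]
        unfolding vertical_stress_def slope_q_def mq_def
        by (simp add: field_simps power2_eq_square)
      finally have "((\<lambda>p. vertical_stress (q, p) * hq (q, p)) has_real_derivative mq (q, p)) (at p)" .
      then show ?thesis by (simp add: has_real_derivative_iff_has_vector_derivative)
    qed
    then have "((\<lambda>p. mq (q, p)) has_integral
        vertical_stress (q, 0) * hq (q, 0) - vertical_stress (q, -1) * hq (q, -1)) {-1..0}"
      by (intro fundamental_theorem_of_calculus_interior continuous_on_mult continuous_on_slice
          cont_vertical_stress conts) auto
    moreover have "hq (q, -1) = 0"
      using partials(1)[of "-1" q] bot DERIV_unique[OF _ DERIV_const] by simp
    ultimately have "integral {-1..0} (\<lambda>p. mq (q, p)) = \<tau> * (h (q, 0) - 1) * hq (q, 0)"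
      using top[of q] by (simp add: vertical_stress_def integral_unique)
    moreover have "((\<lambda>q. integral {-1..0} (\<lambda>p. momentum (q, p))) has_real_derivative
        integral {-1..0} (\<lambda>p. mq (q, p))) (at q)"
      by (intro leibniz dm cont_momentum cmq) auto
    moreover have "((\<lambda>q. h (q, 0)) has_real_derivative hq (q, 0)) (at q)"
      by (rule partials) auto
    ultimately show ?thesis unfolding flow_force_def
      by (auto intro!: derivative_eq_intros)
  qed
  then show ?thesis using DERIV_isconst_all by blast
qed

section \<open>Passage to the limit at an end of the strip\<close>

text \<open>The values of \<open>h\<close>, \<open>hq\<close>, \<open>hp\<close> stay in a compact
  box on which \<open>hp \<ge> \<delta>\<close>, so a continuous \<open>\<Phi>\<close> is bounded
  there and dominated convergence applies. Different choices of \<open>\<Phi>\<close> serve the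
  field equation and the flow force.\<close>

lemma integral_of_limit:
  fixes \<Phi> :: "real \<times> real \<times> real \<times> real \<Rightarrow> real"
  assumes X: "filterlim X Fl sequentially"
    and \<Phi>: "continuous_on ({-M..M} \<times> {-M..M} \<times> {\<delta>..M} \<times> {-1..0}) \<Phi>"
    and lim: "\<And>p. p \<in> {-1..0} \<Longrightarrow> ((\<lambda>q. h (q, p)) \<longlongrightarrow> K p) Fl"
      "\<And>p. p \<in> {-1..0} \<Longrightarrow> ((\<lambda>q. hq (q, p)) \<longlongrightarrow> 0) Fl"
      "\<And>p. p \<in> {-1..0} \<Longrightarrow> ((\<lambda>q. hp (q, p)) \<longlongrightarrow> Kp p) Fl"
    and a: "-1 \<le> a"
  shows "(\<lambda>n. integral {a..0} (\<lambda>s. \<Phi> (h (X n, s), hq (X n, s), hp (X n, s), s)))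
    \<longlonglongrightarrow> integral {a..0} (\<lambda>s. \<Phi> (K s, 0, Kp s, s))"
proof -
  let ?Z = "{-M..M} \<times> {-M..M} \<times> {\<delta>..M} \<times> {-1..0::real}"
  have "compact ?Z" by (intro compact_Times compact_Icc)
  then have "bounded (\<Phi> ` ?Z)" using \<Phi> compact_continuous_image compact_imp_bounded by blast
  then obtain C where C: "\<And>z. z \<in> ?Z \<Longrightarrow> norm (\<Phi> z) \<le> C"
    unfolding bounded_iff by blast
  have inZ: "(h (q, s), hq (q, s), hp (q, s), s) \<in> ?Z" if "s \<in> {-1..0}" for q s
  proof -
    have x: "(q, s) \<in> Rbar" using that by (simp add: Rbar_def)
    show ?thesis
      using bound[OF _ x, of h] bound[OF _ x, of hq] bound[OF _ x, of hp] hp_ge[OF x] that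
      by (simp add: abs_le_iff minus_le_iff)
  qed
  note lims = filterlim_compose[OF lim(1) X] filterlim_compose[OF lim(2) X]
    filterlim_compose[OF lim(3) X]
  have conv: "(\<lambda>n. (h (X n, s), hq (X n, s), hp (X n, s), s)) \<longlonglongrightarrow> (K s, 0, Kp s, s)"
    if "s \<in> {-1..0}" for s
    by (intro tendsto_Pair lims that tendsto_const)
  have "closed ?Z" using \<open>compact ?Z\<close> compact_imp_closed by blast
  \<comment> \<open>Closedness keeps the limit point in the box, where \<open>\<Phi>\<close> is
    known to be continuous.\<close>
  then have limZ: "(K s, 0, Kp s, s) \<in> ?Z" if "s \<in> {-1..0}" for s
    using closed_sequentially[OF _ _ conv[OF that]] inZ[OF that] by blast
  show ?thesis
  proof (rule dominated_convergence(2))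
    fix n
    have "continuous_on {a..0} (\<lambda>s. (h (X n, s), hq (X n, s), hp (X n, s), s))"
      by (intro continuous_on_Pair continuous_on_id
          continuous_on_subset[OF continuous_on_slice[OF conts(1)]]
          continuous_on_subset[OF continuous_on_slice[OF conts(2)]]
          continuous_on_subset[OF continuous_on_slice[OF conts(3)]]) (use a in auto)
    then have "continuous_on {a..0} (\<lambda>s. \<Phi> (h (X n, s), hq (X n, s), hp (X n, s), s))"
      by (rule continuous_on_compose2[OF \<Phi>]) (use inZ a in auto)
    then show "(\<lambda>s. \<Phi> (h (X n, s), hq (X n, s), hp (X n, s), s)) integrable_on {a..0}"
      by (rule integrable_continuous_real)
  next
    show "(\<lambda>s. C) integrable_on {a..0}" by (rule integrable_const_ivl)
  next
    fix n s assume "s \<in> {a..0}"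
    then show "norm (\<Phi> (h (X n, s), hq (X n, s), hp (X n, s), s)) \<le> C"
      using C inZ a by simp
  next
    fix s assume "s \<in> {a..0}"
    then have s: "s \<in> {-1..0}" using a by auto
    show "(\<lambda>n. \<Phi> (h (X n, s), hq (X n, s), hp (X n, s), s)) \<longlonglongrightarrow> \<Phi> (K s, 0, Kp s, s)"
      by (rule continuous_on_tendsto_compose[OF \<Phi> conv[OF s] limZ[OF s]]) (use inZ[OF s] in simp)
  qed
qed

text \<open>Only first derivatives of \<open>h\<close> are shown to converge. The field equation is
  therefore integrated over \<open>{p..0}\<close> before the limit is taken, and the remaining
  second derivatives appear as the \<open>q\<close>-derivative of a convergent integral.\<close>

lemma limit_is_conjugate_flow:
  assumes Fl: "Fl = at_top \<or> Fl = at_bot"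
    and lim: "\<And>p. p \<in> {-1..0} \<Longrightarrow> ((\<lambda>q. h (q, p)) \<longlongrightarrow> K p) Fl"
  obtains Kp where
    "\<And>p. p \<in> {-1..0} \<Longrightarrow> (K has_real_derivative Kp p) (at p within {-1..0})"
    "continuous_on {-1..0} Kp" "\<And>p. p \<in> {-1..0} \<Longrightarrow> Kp p > 0" "K (-1) = 0"
    "\<And>p. p \<in> {-1..0} \<Longrightarrow> 1 / (2 * (Kp p)\<^sup>2) - 1 / (2 * (Hp p)\<^sup>2)
        = integral {p..0} (\<lambda>t. \<sigma> t * (K t - H t)) - \<tau> * (K 0 - H 0)"
    "integral {-1..0} (\<lambda>p. 1 / (2 * Kp p) + Kp p / (2 * (Hp p)\<^sup>2) + \<sigma> p * (K p - H p)\<^sup>2 / 2)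
        - \<tau> * (K 0 - H 0)\<^sup>2 / 2 = flow_force 0"
proof -
  have nb: "Fl \<noteq> bot" using Fl by (metis trivial_limit_at_top_linorder trivial_limit_at_bot_linorder)
  obtain X where X: "filterlim X Fl sequentially"
  proof (cases "Fl = at_top")
    case True
    then show thesis using that filterlim_real_sequentially by blast
  next
    case False
    have "filterlim (\<lambda>n. - real n) at_bot sequentially"
      unfolding filterlim_uminus_at_bot by (simp add: filterlim_real_sequentially)
    then show thesis using that False Fl by blast
  qed
  have mem: "(q, p) \<in> Rbar" if "p \<in> {-1..0}" for q p using that by (simp add: Rbar_def)
  have shift: "filterlim (\<lambda>q. s + q) Fl Fl" for s :: real
    using Fl filterlim_tendsto_add_at_top[OF tendsto_const filterlim_ident, of s]
      filterlim_tendsto_add_at_bot_iff[OF tendsto_const, of s "\<lambda>q. q" at_bot] filterlim_ident by auto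
  have hq0: "((\<lambda>q. hq (q, p)) \<longlongrightarrow> 0) Fl" if p: "p \<in> {-1..0}" for p
  proof -
    \<comment> \<open>The interpolation lemma is applied to the translates
      \<open>h (s + q, p)\<close> as functions of \<open>s\<close>; their limit is constant in
      \<open>s\<close>, so the limit of \<open>hq\<close> is its derivative, zero.\<close>
    obtain G where G: "((\<lambda>q. hq (q, p)) \<longlongrightarrow> G) Fl" "((\<lambda>s::real. K p) has_real_derivative G) (at 0 within UNIV)"
    proof (rule tendsto_derivative_of_quadratic_remainder
        [of UNIV "\<lambda>q s. h (s + q, p)" "\<lambda>s. K p" Fl 0 "\<lambda>q. hq (q, p)" M M X])
      show "((\<lambda>q. h (s + q, p)) \<longlongrightarrow> K p) Fl" for s
        by (rule filterlim_compose[OF lim[OF p] shift])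
      show "\<bar>h (s + q, p) - h (0 + q, p) - hq (q, p) * (s - 0)\<bar> \<le> M * (s - 0)\<^sup>2" for q s
        using derivative_remainder_bound[of UNIV "\<lambda>t. h (t, p)" "\<lambda>t. hq (t, p)" "\<lambda>t. hqq (t, p)" M q "s + q"]
          partials(1,3)[OF p] bound[OF _ mem[OF p], of hqq] by simp
      show "\<bar>hq (q, p)\<bar> \<le> M" for q using bound[OF _ mem[OF p]] by simp
    qed (use X in \<open>auto simp: islimpt_UNIV\<close>)
    then have "G = 0" using DERIV_unique[OF _ DERIV_const] by blast
    with G show ?thesis by simp
  qed
  have "\<exists>G. ((\<lambda>q. hp (q, p)) \<longlongrightarrow> G) Fl \<and> (K has_real_derivative G) (at p within {-1..0})"
    if p: "p \<in> {-1..0}" for p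
  proof (rule tendsto_derivative_of_quadratic_remainder
        [of "{-1..0}" "\<lambda>q s. h (q, s)" K Fl p "\<lambda>q. hp (q, p)" M M X])
    show "\<bar>h (q, s) - h (q, p) - hp (q, p) * (s - p)\<bar> \<le> M * (s - p)\<^sup>2" if "s \<in> {-1..0}" for q s
      using derivative_remainder_bound[of "{-1..0}" "\<lambda>s. h (q, s)" "\<lambda>s. hp (q, s)" "\<lambda>s. hpp (q, s)" M p s]
        partials(2,6) bound[OF _ mem, of hpp] that p by simp
    show "\<bar>hp (q, p)\<bar> \<le> M" for q using bound[OF _ mem[OF p]] by simp
    show "p islimpt {-1..0}" using p islimpt_Icc[of "-1" 0 p] by simp
  qed (use X lim p in auto)
  then obtain Kp where hpK: "\<And>p. p \<in> {-1..0} \<Longrightarrow> ((\<lambda>q. hp (q, p)) \<longlongrightarrow> Kp p) Fl"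
    and dK: "\<And>p. p \<in> {-1..0} \<Longrightarrow> (K has_real_derivative Kp p) (at p within {-1..0})"
    by metis
  have Kp: "Kp p \<ge> \<delta>" if "p \<in> {-1..0}" for p
    by (rule tendsto_lowerbound[OF hpK[OF that]]) (use hp_ge[OF mem[OF that]] nb in auto)
  then have Kp_pos: "Kp p > 0" if "p \<in> {-1..0}" for p using that \<delta>_pos by force
  \<comment> \<open>The bound on \<open>hpp\<close> makes the slices of \<open>hp\<close> Lipschitz
    uniformly in \<open>q\<close>, a property that survives pointwise limits and yields continuity
    of \<open>Kp\<close>.\<close>
  have "M-lipschitz_on {-1..0} Kp"
  proof (rule lipschitz_onI)
    fix x y :: real assume xy: "x \<in> {-1..0}" "y \<in> {-1..0}"
    have "\<bar>hp (q, x) - hp (q, y)\<bar> \<le> M * \<bar>x - y\<bar>" for q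
      using field_differentiable_bound[of "{-1..0}" "\<lambda>s. hp (q, s)" "\<lambda>s. hpp (q, s)" M x y]
        partials(6) bound[OF _ mem, of hpp] xy by simp
    moreover have "((\<lambda>q. \<bar>hp (q, x) - hp (q, y)\<bar>) \<longlongrightarrow> \<bar>Kp x - Kp y\<bar>) Fl"
      by (intro tendsto_intros hpK xy)
    ultimately have "\<bar>Kp x - Kp y\<bar> \<le> M * \<bar>x - y\<bar>"
      using tendsto_upperbound[OF _ _ nb] by fastforce
    then show "dist (Kp x) (Kp y) \<le> M * dist x y" by (simp add: dist_real_def)
  next
    show "0 \<le> M" using bound[OF _ mem, of h 0] by force
  qed
  then have cKp: "continuous_on {-1..0} Kp" by (rule lipschitz_on_continuous_on)
  have K_bot: "K (-1) = 0"
    using lim[of "-1"] bot tendsto_unique[OF nb _ tendsto_const] by simp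
  note iol = integral_of_limit[OF _ _ lim hq0 hpK]
  have cont4: "continuous_on (A \<times> B \<times> C \<times> {-1..0}) (\<lambda>z. f (snd (snd (snd z))))"
    if "continuous_on {-1..0} f" for f :: "real \<Rightarrow> real" and A B C :: "real set"
    by (rule continuous_on_compose2[OF that]) (auto intro!: continuous_intros)
  have ode: "1 / (2 * (Kp p)\<^sup>2) - 1 / (2 * (Hp p)\<^sup>2)
        = integral {p..0} (\<lambda>t. \<sigma> t * (K t - H t)) - \<tau> * (K 0 - H 0)" if p: "p \<in> {-1..0}" for p
  proof -
    have sub: "{p..0} \<subseteq> {-1..0}" using p by auto
    let ?R = "\<lambda>q. integral {p..0} (\<lambda>s. \<sigma> s * (h (q, s) - H s)) - \<tau> * (h (q, 0) - H 0)
        + vertical_stress (q, p)"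
    \<comment> \<open>Integrating the interior equation from \<open>p\<close> to the surface and
      inserting the top condition leaves only \<open>h\<close>, \<open>hq\<close> and
      \<open>hp\<close> in \<open>?R\<close>.\<close>
    have slope: "integral {p..0} (\<lambda>s. slope_q (q, s)) = ?R q" for q
    proof -
      have "((\<lambda>s. \<sigma> s * (h (q, s) - H s) - slope_q (q, s)) has_integral
          vertical_stress (q, 0) - vertical_stress (q, p)) {p..0}"
      proof (rule fundamental_theorem_of_calculus_interior)
        show "continuous_on {p..0} (\<lambda>s. vertical_stress (q, s))"
          by (rule continuous_on_subset[OF continuous_on_slice[OF cont_vertical_stress] sub])
        show "((\<lambda>s. vertical_stress (q, s)) has_vector_derivative
            \<sigma> s * (h (q, s) - H s) - slope_q (q, s)) (at s)" if "s \<in> {p<..<0}" for s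
          using interior[of s q] that p
          by (simp add: vertical_stress_def slope_q_def has_real_derivative_iff_has_vector_derivative)
      qed (use p in auto)
      then have "integral {p..0} (\<lambda>s. \<sigma> s * (h (q, s) - H s) - slope_q (q, s))
          = vertical_stress (q, 0) - vertical_stress (q, p)"
        by (rule integral_unique)
      moreover have "(\<lambda>s. \<sigma> s * (h (q, s) - H s)) integrable_on {p..0}"
        by (intro integrable_continuous_real continuous_on_subset[OF _ sub] continuous_intros
            \<sigma>_cont H_cont continuous_on_slice conts)
      moreover have "(\<lambda>s. slope_q (q, s)) integrable_on {p..0}"
        by (intro integrable_continuous_real continuous_on_subset[OF _ sub]
            continuous_on_slice cont_slope_q)
      moreover have "vertical_stress (q, 0) = \<tau> * (h (q, 0) - H 0)"
        using top[of q] by (simp add: vertical_stress_def H_top)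
      ultimately show ?thesis by (simp only: integral_diff)
    qed
    let ?L = "integral {p..0} (\<lambda>t. \<sigma> t * (K t - H t)) - \<tau> * (K 0 - H 0)
        + (- (1 + 0\<^sup>2) / (2 * (Kp p)\<^sup>2) + 1 / (2 * (Hp p)\<^sup>2))"
    \<comment> \<open>\<open>?R\<close> is the derivative of the integral of \<open>hq / hp\<close>,
      which tends to \<open>0\<close> because \<open>hq\<close> does; hence the limit
      \<open>?L\<close> of \<open>?R\<close> vanishes.\<close>
    have "?L = 0"
    proof (rule limit_of_derivative_eq_zero[OF Fl])
      show "((\<lambda>q. integral {p..0} (\<lambda>s. hq (q, s) / hp (q, s))) has_real_derivative ?R q) (at q)" for q
        unfolding slope[symmetric]
      proof (rule leibniz[OF _ _ cont_slope_q sub])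
        show "((\<lambda>t. hq (t, s) / hp (t, s)) has_real_derivative slope_q (q, s)) (at q)"
          if "s \<in> {p..0}" for q s
          using partials(3,5)[of s q] that p hp_pos[of s q] unfolding slope_q_def
          by (auto intro!: derivative_eq_intros simp: power2_eq_square)
        show "continuous_on Rbar (\<lambda>x. hq x / hp x)"
          by (intro continuous_intros conts) (use hp_nonzero in auto)
      qed
    next
      fix X assume X: "filterlim X Fl sequentially"
      show "(\<lambda>n. integral {p..0} (\<lambda>s. hq (X n, s) / hp (X n, s))) \<longlonglongrightarrow> 0"
        using iol[OF X, of "\<lambda>z. fst (snd z) / fst (snd (snd z))" p] \<delta>_pos p
        by (simp add: continuous_intros)
      have "(\<lambda>n. integral {p..0} (\<lambda>s. \<sigma> s * (h (X n, s) - H s)))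
          \<longlonglongrightarrow> integral {p..0} (\<lambda>t. \<sigma> t * (K t - H t))"
        using iol[OF X, of "\<lambda>z. \<sigma> (snd (snd (snd z))) * (fst z - H (snd (snd (snd z))))" p] p
        by (simp add: continuous_intros cont4 \<sigma>_cont H_cont)
      moreover have "(\<lambda>n. h (X n, 0)) \<longlonglongrightarrow> K 0"
        by (rule filterlim_compose[OF lim X]) auto
      moreover have "(\<lambda>n. hq (X n, p)) \<longlonglongrightarrow> 0" "(\<lambda>n. hp (X n, p)) \<longlonglongrightarrow> Kp p"
        by (rule filterlim_compose[OF hq0[OF p] X], rule filterlim_compose[OF hpK[OF p] X])
      ultimately show "(\<lambda>n. ?R (X n)) \<longlonglongrightarrow> ?L"
        unfolding vertical_stress_def snd_conv
        using Kp_pos[OF p] by (intro tendsto_intros) auto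
    qed
    then show ?thesis by (simp add: field_simps)
  qed
  have "(\<lambda>n. flow_force (X n)) \<longlonglongrightarrow>
      integral {-1..0} (\<lambda>p. (1 - 0\<^sup>2) / (2 * Kp p) + Kp p / (2 * (Hp p)\<^sup>2) + \<sigma> p * (K p - H p)\<^sup>2 / 2)
      - \<tau> * (K 0 - 1)\<^sup>2 / 2" (is "_ \<longlonglongrightarrow> ?J")
  proof -
    have "continuous_on ({-M..M} \<times> {-M..M} \<times> {\<delta>..M} \<times> {-1..0})
        (\<lambda>z. (1 - (fst (snd z))\<^sup>2) / (2 * fst (snd (snd z)))
          + fst (snd (snd z)) / (2 * (Hp (snd (snd (snd z))))\<^sup>2)
          + \<sigma> (snd (snd (snd z))) * (fst z - H (snd (snd (snd z))))\<^sup>2 / 2)"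
      by (intro continuous_intros cont4 \<sigma>_cont H_cont Hp_cont)
        (use \<delta>_pos Hp_pos in \<open>auto simp: less_le\<close>)
    from iol[OF X this, of "-1"] have "(\<lambda>n. integral {-1..0} (\<lambda>p. momentum (X n, p))) \<longlonglongrightarrow>
        integral {-1..0} (\<lambda>p. (1 - 0\<^sup>2) / (2 * Kp p) + Kp p / (2 * (Hp p)\<^sup>2) + \<sigma> p * (K p - H p)\<^sup>2 / 2)"
      by (simp add: momentum_def)
    moreover have "(\<lambda>n. h (X n, 0)) \<longlonglongrightarrow> K 0"
      by (rule filterlim_compose[OF lim X]) auto
    ultimately show ?thesis unfolding flow_force_def by (intro tendsto_intros) auto
  qed
  then have "(\<lambda>n::nat. flow_force 0) \<longlonglongrightarrow> ?J" by (simp only: flow_force_constant[of "X _"])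
  then have "?J = flow_force 0" by (rule LIMSEQ_unique[OF _ tendsto_const])
  then have J: "integral {-1..0} (\<lambda>p. 1 / (2 * Kp p) + Kp p / (2 * (Hp p)\<^sup>2) + \<sigma> p * (K p - H p)\<^sup>2 / 2)
        - \<tau> * (K 0 - H 0)\<^sup>2 / 2 = flow_force 0" by (simp add: H_top)
  show thesis by (rule that[OF dK cKp Kp_pos K_bot ode J])
qed

section \<open>Comparison of the two ends\<close>

text \<open>The end with limit \<open>H\<close> evaluates the constant flow force as the integral of
  \<open>1 / Hp\<close>. The limit \<open>K\<close> at the other end is a conjugate flow with this
  same value, so the ordered comparison applies. Keeping both filters variable covers the two
  orientations at once.\<close>

lemma no_ordered_front:
  assumes Fl: "Fl = at_top \<or> Fl = at_bot" "Fl' = at_top \<or> Fl' = at_bot"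
    and limH: "\<And>p. p \<in> {-1..0} \<Longrightarrow> ((\<lambda>q. h (q, p)) \<longlongrightarrow> H p) Fl'"
    and limK: "\<And>p. p \<in> {-1..0} \<Longrightarrow> ((\<lambda>q. h (q, p)) \<longlongrightarrow> K p) Fl"
    and \<sigma>: "\<And>p. p \<in> {-1..0} \<Longrightarrow> \<sigma> p \<le> 0" and \<tau>: "\<tau> \<ge> 0"
    and ord: "(\<forall>p\<in>{-1..0}. K p \<ge> H p) \<or> (\<forall>p\<in>{-1..0}. K p \<le> H p)"
    and p: "p \<in> {-1..0}"
  shows "K p = H p"
proof -
  obtain Gp where dG: "\<And>p. p \<in> {-1..0} \<Longrightarrow> (H has_real_derivative Gp p) (at p within {-1..0})"
    and G: "integral {-1..0} (\<lambda>p. 1 / (2 * Gp p) + Gp p / (2 * (Hp p)\<^sup>2) + \<sigma> p * (H p - H p)\<^sup>2 / 2)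
        - \<tau> * (H 0 - H 0)\<^sup>2 / 2 = flow_force 0"
  proof (rule limit_is_conjugate_flow[OF Fl(2) limH])
    fix Gp
    assume "\<And>p. p \<in> {-1..0} \<Longrightarrow> (H has_real_derivative Gp p) (at p within {-1..0})"
      and "integral {-1..0} (\<lambda>p. 1 / (2 * Gp p) + Gp p / (2 * (Hp p)\<^sup>2) + \<sigma> p * (H p - H p)\<^sup>2 / 2)
        - \<tau> * (H 0 - H 0)\<^sup>2 / 2 = flow_force 0"
    then show thesis by (rule that)
  qed auto
  \<comment> \<open>The limit lemma only asserts that some derivative of \<open>H\<close> exists, so
    it has to be identified with \<open>Hp\<close>.\<close>
  have "Gp p = Hp p" if "p \<in> {-1..0}" for p
    by (rule has_real_derivative_unique_Icc[OF dG[OF that] H_deriv[OF that]]) (use that in auto)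
  then have "integral {-1..0} (\<lambda>p. 1 / (2 * Gp p) + Gp p / (2 * (Hp p)\<^sup>2) + \<sigma> p * (H p - H p)\<^sup>2 / 2)
      = integral {-1..0} (\<lambda>p. 1 / Hp p)"
    using Hp_pos by (intro integral_cong) (auto simp: field_simps power2_eq_square less_le)
  with G have FH: "flow_force 0 = integral {-1..0} (\<lambda>p. 1 / Hp p)" by simp
  obtain s :: real where s: "s = 1 \<or> s = -1" "\<And>p. p \<in> {-1..0} \<Longrightarrow> s * (K p - H p) \<ge> 0"
  proof (cases "\<forall>p\<in>{-1..0}. K p \<ge> H p")
    case True
    then show thesis using that[of 1] by simp
  next
    case False
    then have "\<forall>p\<in>{-1..0}. K p \<le> H p" using ord by blast
    then show thesis using that[of "-1"] by simp
  qed
  show ?thesis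
  proof (rule limit_is_conjugate_flow[OF Fl(1) limK])
    fix Kp
    assume *: "\<And>p. p \<in> {-1..0} \<Longrightarrow> (K has_real_derivative Kp p) (at p within {-1..0})"
      "continuous_on {-1..0} Kp" "\<And>p. p \<in> {-1..0} \<Longrightarrow> Kp p > 0" "K (-1) = 0"
      "\<And>p. p \<in> {-1..0} \<Longrightarrow> 1 / (2 * (Kp p)\<^sup>2) - 1 / (2 * (Hp p)\<^sup>2)
        = integral {p..0} (\<lambda>t. \<sigma> t * (K t - H t)) - \<tau> * (K 0 - H 0)"
      "integral {-1..0} (\<lambda>p. 1 / (2 * Kp p) + Kp p / (2 * (Hp p)\<^sup>2) + \<sigma> p * (K p - H p)\<^sup>2 / 2)
        - \<tau> * (K 0 - H 0)\<^sup>2 / 2 = flow_force 0"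
    have b: "K (-1) = H (-1)" using *(4) H_bot by simp
    show "K p = H p"
      by (rule ordered_conjugate_flow_eq[OF H_deriv *(1) Hp_cont *(2) \<sigma>_cont Hp_pos *(3) \<sigma> \<tau> b *(5)
            *(6)[unfolded FH] s p])
  qed auto
qed

end

section \<open>Regularity of the data and the theorem\<close>

text \<open>Uniqueness of derivatives on an interval identifies \<open>f'\<close> with the member
  \<open>D 1\<close> of the witnessing chain, and \<open>2 \<le> k\<close> makes \<open>D 1\<close>
  differentiable, hence continuous.\<close>

lemma holder_Ck_derivative_continuous:
  assumes "holder_Ck k \<alpha> a b f" "2 \<le> k" "a < b"
    and f': "\<And>x. x \<in> {a..b} \<Longrightarrow> (f has_real_derivative f' x) (at x within {a..b})"
  shows "continuous_on {a..b} f'"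
proof -
  obtain D where D0: "\<forall>x\<in>{a..b}. D 0 x = f x"
    and D: "\<forall>j<k. \<forall>x\<in>{a..b}. (D j has_real_derivative D (Suc j) x) (at x within {a..b})"
    using assms(1) unfolding holder_Ck_def by blast
  have D1: "D 1 x = f' x" if x: "x \<in> {a..b}" for x
  proof (rule has_real_derivative_unique_Icc[OF _ f'[OF x] \<open>a < b\<close> x])
    have "(D 0 has_real_derivative D 1 x) (at x within {a..b})" using D x \<open>2 \<le> k\<close> by simp
    then show "(f has_real_derivative D 1 x) (at x within {a..b})"
      by (rule has_field_derivative_transform_within[OF _ zero_less_one x]) (use D0 in auto)
  qed
  have "\<And>x. x \<in> {a..b} \<Longrightarrow> (D 1 has_real_derivative D (Suc 1) x) (at x within {a..b})"
    using D \<open>2 \<le> k\<close> by simp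
  then have "continuous_on {a..b} (D 1)" by (rule DERIV_continuous_on)
  then show ?thesis by (rule continuous_on_eq) (use D1 in auto)
qed

theorem theorem4p8:
  fixes \<alpha> F :: real
    and \<rho> \<rho>p H Hp Hplus Hminus :: "real \<Rightarrow> real"
    and h hq hp :: "real \<times> real \<Rightarrow> real"
  assumes alpha: "0 < \<alpha>" "\<alpha> < 1"
    and rho_reg: "holder_Ck 2 \<alpha> (-1) 0 \<rho>"
    and rho_deriv: "\<forall>p\<in>{-1..0}. (\<rho> has_real_derivative \<rho>p p) (at p within {-1..0})"
    and rho_pos: "\<forall>p\<in>{-1..0}. \<rho> p > 0"
    and rho_mono: "\<forall>p\<in>{-1..0}. \<rho>p p \<le> 0"
    and H_reg: "holder_Ck 3 \<alpha> (-1) 0 H"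
    and H_deriv: "\<forall>p\<in>{-1..0}. (H has_real_derivative Hp p) (at p within {-1..0})"
    and H_bot: "H (-1) = 0" and H_top: "H 0 = 1"
    and H_incr: "\<forall>p\<in>{-1..0}. Hp p > 0"
    and F_pos: "F > 0"
    and h_C2: "C2_bounded_strip h hq hp"
    and h_eq_R: "\<forall>q p. -1 < p \<and> p < 0 \<longrightarrow>
       (\<exists>a b.
          ((\<lambda>s. - (1 + (hq (q, s))\<^sup>2) / (2 * (hp (q, s))\<^sup>2) + 1 / (2 * (Hp s)\<^sup>2))
             has_real_derivative a) (at p) \<and>
          ((\<lambda>t. hq (t, p) / hp (t, p)) has_real_derivative b) (at q) \<and>
          a + b - (1 / F\<^sup>2) * \<rho>p p * (h (q, p) - H p) = 0)"
    and h_eq_T: "\<forall>q. (1 + (hq (q, 0))\<^sup>2) / (2 * (hp (q, 0))\<^sup>2) - 1 / (2 * (Hp 0)\<^sup>2)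
                     + (1 / F\<^sup>2) * \<rho> 0 * (h (q, 0) - 1) = 0"
    and h_eq_B: "\<forall>q. h (q, -1) = 0"
    and hp_inf: "\<exists>\<delta>>0. \<forall>q p. -1 < p \<and> p < 0 \<longrightarrow> hp (q, p) \<ge> \<delta>"
    and lim_plus: "\<forall>p\<in>{-1..0}. ((\<lambda>q. h (q, p)) \<longlongrightarrow> Hplus p) at_top"
    and lim_minus: "\<forall>p\<in>{-1..0}. ((\<lambda>q. h (q, p)) \<longlongrightarrow> Hminus p) at_bot"
  shows "(((\<forall>p\<in>{-1..0}. Hplus p \<ge> Hminus p \<and> Hminus p = H p) \<or>
           (\<forall>p\<in>{-1..0}. Hplus p \<le> Hminus p \<and> Hminus p = H p))
          \<longrightarrow> (\<forall>p\<in>{-1..0}. Hplus p = H p \<and> Hminus p = H p)) \<and>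
         (((\<forall>p\<in>{-1..0}. Hminus p \<ge> Hplus p \<and> Hplus p = H p) \<or>
           (\<forall>p\<in>{-1..0}. Hminus p \<le> Hplus p \<and> Hplus p = H p))
          \<longrightarrow> (\<forall>p\<in>{-1..0}. Hplus p = H p \<and> Hminus p = H p))"
proof -
  obtain hqq hqp hpq hpp where
    parts: "has_partials_strip h hq hp" "has_partials_strip hq hqq hqp" "has_partials_strip hp hpq hpp"
    and cb: "\<forall>g\<in>{h, hq, hp, hqq, hqp, hpq, hpp}. continuous_on Rbar g \<and> bounded_strip g"
    using h_C2 unfolding C2_bounded_strip_def by blast
  let ?S = "{h, hq, hp, hqq, hqp, hpq, hpp}"
  have "\<forall>g\<in>?S. \<exists>m. \<forall>x\<in>Rbar. \<bar>g x\<bar> \<le> m"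
    using cb unfolding bounded_strip_def by blast
  \<comment> \<open>Each function comes with its own bound; the maximum over the finite set
    \<open>?S\<close> serves them all.\<close>
  from bchoice[OF this] obtain m where m: "\<forall>g\<in>?S. \<forall>x\<in>Rbar. \<bar>g x\<bar> \<le> m g" ..
  have M: "\<bar>g x\<bar> \<le> Max (m ` ?S)" if "g \<in> ?S" "x \<in> Rbar" for g x
  proof -
    have "m g \<le> Max (m ` ?S)" by (intro Max_ge imageI that(1)) auto
    then show ?thesis using m that by (meson order_trans)
  qed
  obtain \<delta> where \<delta>: "\<delta> > 0" "\<forall>q p. -1 < p \<and> p < 0 \<longrightarrow> hp (q, p) \<ge> \<delta>"
    using hp_inf by blast
  have chp: "continuous_on Rbar hp" using cb by blast
  \<comment> \<open>The lower bound is given on the open strip and extends to the boundary by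
    continuity on vertical slices.\<close>
  have hp_ge: "hp x \<ge> \<delta>" if x: "x \<in> Rbar" for x
  proof -
    have cl: "closure {-1<..<0::real} = {-1..0}" by simp
    have "hp (fst x, p) \<ge> \<delta>" if "p \<in> {-1..0}" for p
      using continuous_ge_on_closure[of "{-1<..<0}" "\<lambda>p. hp (fst x, p)" p \<delta>]
        continuous_on_slice[OF chp] that \<delta>(2) unfolding cl by auto
    then show ?thesis using x by (cases x) (auto simp: Rbar_def)
  qed
  interpret strip_solution "\<lambda>p. \<rho>p p / F\<^sup>2" H Hp "\<rho> 0 / F\<^sup>2" "Max (m ` ?S)" \<delta> h hq hp hqq hqp hpq hpp
  proof unfold_locales
    show "continuous_on {-1..0} (\<lambda>p. \<rho>p p / F\<^sup>2)"
      using holder_Ck_derivative_continuous[OF rho_reg] rho_deriv F_pos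
      by (intro continuous_intros) auto
    show "continuous_on {-1..0} Hp"
      using holder_Ck_derivative_continuous[OF H_reg] H_deriv by auto
    show "((\<lambda>s. - (1 + (hq (q, s))\<^sup>2) / (2 * (hp (q, s))\<^sup>2) + 1 / (2 * (Hp s)\<^sup>2))
          has_real_derivative \<rho>p p / F\<^sup>2 * (h (q, p) - H p)
            - (hqq (q, p) * hp (q, p) - hq (q, p) * hpq (q, p)) / (hp (q, p))\<^sup>2) (at p)"
      if p: "-1 < p" "p < 0" for p q
    proof -
      obtain a b where a: "((\<lambda>s. - (1 + (hq (q, s))\<^sup>2) / (2 * (hp (q, s))\<^sup>2) + 1 / (2 * (Hp s)\<^sup>2))
             has_real_derivative a) (at p)"
        and b: "((\<lambda>t. hq (t, p) / hp (t, p)) has_real_derivative b) (at q)"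
        and ab: "a + b - (1 / F\<^sup>2) * \<rho>p p * (h (q, p) - H p) = 0"
        using h_eq_R p by blast
      have d: "((\<lambda>t. hq (t, p)) has_real_derivative hqq (q, p)) (at q)"
        "((\<lambda>t. hp (t, p)) has_real_derivative hpq (q, p)) (at q)"
        using parts(2,3) p by (auto simp: has_partials_strip_def)
      have "hp (q, p) \<noteq> 0" using \<delta> p by (metis linorder_not_le)
      \<comment> \<open>The quotient rule determines the derivative \<open>b\<close> that the
        equation merely asserts to exist; the equation then yields \<open>a\<close>.\<close>
      from DERIV_divide[OF d this] have
        "b = (hqq (q, p) * hp (q, p) - hq (q, p) * hpq (q, p)) / (hp (q, p))\<^sup>2"
        using DERIV_unique[OF b] by (simp add: power2_eq_square)
      with ab have "a = \<rho>p p / F\<^sup>2 * (h (q, p) - H p)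
          - (hqq (q, p) * hp (q, p) - hq (q, p) * hpq (q, p)) / (hp (q, p))\<^sup>2"
        by simp
      with a show ?thesis by simp
    qed
    show "- (1 + (hq (q, 0))\<^sup>2) / (2 * (hp (q, 0))\<^sup>2) + 1 / (2 * (Hp 0)\<^sup>2)
        = \<rho> 0 / F\<^sup>2 * (h (q, 0) - 1)" for q
    proof -
      have "(1 + (hq (q, 0))\<^sup>2) / (2 * (hp (q, 0))\<^sup>2) - 1 / (2 * (Hp 0)\<^sup>2)
          + \<rho> 0 / F\<^sup>2 * (h (q, 0) - 1) = 0" using h_eq_T by simp
      then show ?thesis unfolding minus_divide_left[symmetric] by linarith
    qed
    show "continuous_on Rbar g" if "g \<in> ?S" for g using cb that by blast
    show "\<bar>g x\<bar> \<le> Max (m ` ?S)" if "g \<in> ?S" "x \<in> Rbar" for g x by (rule M[OF that])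
  qed (use parts hp_ge \<delta>(1) H_deriv H_incr H_bot H_top h_eq_B in auto)
  have \<sigma>: "\<rho>p p / F\<^sup>2 \<le> 0" if "p \<in> {-1..0}" for p
    using rho_mono that by (simp add: divide_nonpos_nonneg)
  have \<tau>: "\<rho> 0 / F\<^sup>2 \<ge> 0" using rho_pos by (simp add: less_imp_le)
  have right: "Hplus p = H p"
    if "\<forall>p\<in>{-1..0}. Hminus p = H p" "(\<forall>p\<in>{-1..0}. Hplus p \<ge> H p) \<or> (\<forall>p\<in>{-1..0}. Hplus p \<le> H p)"
      "p \<in> {-1..0}" for p
    by (rule no_ordered_front[of at_top at_bot]) (use that lim_plus lim_minus \<sigma> \<tau> in auto)
  have left: "Hminus p = H p"
    if "\<forall>p\<in>{-1..0}. Hplus p = H p" "(\<forall>p\<in>{-1..0}. Hminus p \<ge> H p) \<or> (\<forall>p\<in>{-1..0}. Hminus p \<le> H p)"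
      "p \<in> {-1..0}" for p
    by (rule no_ordered_front[of at_bot at_top]) (use that lim_plus lim_minus \<sigma> \<tau> in auto)
  show ?thesis
  proof (intro conjI impI ballI)
    fix p :: real assume p: "p \<in> {-1..0}"
    assume *: "(\<forall>p\<in>{-1..0}. Hplus p \<ge> Hminus p \<and> Hminus p = H p) \<or>
           (\<forall>p\<in>{-1..0}. Hplus p \<le> Hminus p \<and> Hminus p = H p)"
    then show "Hminus p = H p" using p by blast
    show "Hplus p = H p" using * by (intro right p) (force, metis)
  next
    fix p :: real assume p: "p \<in> {-1..0}"
    assume *: "(\<forall>p\<in>{-1..0}. Hminus p \<ge> Hplus p \<and> Hplus p = H p) \<or>
           (\<forall>p\<in>{-1..0}. Hminus p \<le> Hplus p \<and> Hplus p = H p)"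
    then show "Hplus p = H p" using p by blast
    show "Hminus p = H p" using * by (intro left p) (force, metis)
  qed
qed

end
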